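(* Let $n=4$ and consider the square board of $(n+1)\times(n+1)=5\times 5$ cells. The number of equivalence classes of closed knight paths of length $4$ on this board is exactly $3$.
   Context: Cells of an $m\times m$ board are identified with pairs $(i,j)\in\{1,\dots,m\}^2$. Two cells $(i,j),(i',j')$ are a knight's move apart if $\{|i-i'|,|j-j'|\}=\{1,2\}$. A closed knight path of length $n$ on the board is a set of $n$ distinct cells that can be listed as $c_1,\dots,c_n$ so that $c_k$ and $c_{k+1}$ are a knight's move apart for $k=1,\dots,n-1$, and $c_n$ and $c_1$ are a knight's move apart (i.e. the set can be traversed by a closed knight path visiting each of its cells exactly once). Two such sets are equivalent if one can be obtained from the other by a finite sequence of the following transformations, each keeping all cells on the board: translation (shifting every cell by one step up, down, left or right), rotation of the board by $90^\circ$, and reflection of the board (these rotations and reflections generate the dihedral group of order 8 of symmetries of the square board). *)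

theory Defs
  imports Main
begin

type_synonym cell = "int \<times> int"

definition board :: "nat \<Rightarrow> cell set" where
  "board m = {1..int m} \<times> {1..int m}"

definition knight_move :: "cell \<Rightarrow> cell \<Rightarrow> bool" where
  "knight_move c d \<longleftrightarrow> {\<bar>fst c - fst d\<bar>, \<bar>snd c - snd d\<bar>} = {1, 2}"

definition closed_knight_paths :: "nat \<Rightarrow> nat \<Rightarrow> cell set set" where
  "closed_knight_paths m n =
     {S. S \<subseteq> board m \<and>
         (\<exists>cs. length cs = n \<and> distinct cs \<and> set cs = S \<and>
               (\<forall>k. Suc k < n \<longrightarrow> knight_move (cs ! k) (cs ! Suc k)) \<and>
               knight_move (last cs) (hd cs))}"

definition unit_shifts :: "(cell \<Rightarrow> cell) set" where
  "unit_shifts =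
     {\<lambda>(i, j). (i + 1, j), \<lambda>(i, j). (i - 1, j), \<lambda>(i, j). (i, j + 1), \<lambda>(i, j). (i, j - 1)}"

definition quarter_turns :: "nat \<Rightarrow> (cell \<Rightarrow> cell) set" where
  "quarter_turns m =
     {\<lambda>(i, j). (j, int m + 1 - i), \<lambda>(i, j). (int m + 1 - j, i)}"

definition board_reflections :: "nat \<Rightarrow> (cell \<Rightarrow> cell) set" where
  "board_reflections m =
     {\<lambda>(i, j). (int m + 1 - i, j), \<lambda>(i, j). (i, int m + 1 - j),
      \<lambda>(i, j). (j, i), \<lambda>(i, j). (int m + 1 - j, int m + 1 - i)}"

definition elementary_step :: "nat \<Rightarrow> cell set \<Rightarrow> cell set \<Rightarrow> bool" where
  "elementary_step m S T \<longleftrightarrow>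
     S \<subseteq> board m \<and> T \<subseteq> board m \<and>
     (\<exists>f \<in> unit_shifts \<union> quarter_turns m \<union> board_reflections m. T = f ` S)"

definition knight_path_equiv :: "nat \<Rightarrow> nat \<Rightarrow> (cell set \<times> cell set) set" where
  "knight_path_equiv m n =
     {(S, T). S \<in> closed_knight_paths m n \<and> T \<in> closed_knight_paths m n \<and>
              (elementary_step m)\<^sup>*\<^sup>* S T}"

lemma elementary_step_sym:
  assumes "elementary_step m S T"
  shows "elementary_step m T S"
proof -
  let ?F = "unit_shifts \<union> quarter_turns m \<union> board_reflections m"
  from assms obtain f where f: "f \<in> ?F" "T = f ` S" and b: "S \<subseteq> board m" "T \<subseteq> board m"
    unfolding elementary_step_def by blast
  have "\<exists>g \<in> ?F. \<forall>x. g (f x) = x"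
    using f(1) unfolding unit_shifts_def quarter_turns_def board_reflections_def Un_iff insert_iff
      empty_iff bex_Un bex_simps(5) bex_simps(7)
    by (elim disjE) (simp_all add: split_paired_all)
  then obtain g where g: "g \<in> ?F" "\<And>x. g (f x) = x" by blast
  have "S = g ` T" using g(2) f(2) by (simp add: image_image)
  with g(1) b show ?thesis unfolding elementary_step_def by blast
qed

lemma equiv_knight_path_equiv:
  "equiv (closed_knight_paths m n) (knight_path_equiv m n)"
proof -
  have "symp (elementary_step m)"
    by (rule sympI) (rule elementary_step_sym)
  then have "symp (elementary_step m)\<^sup>*\<^sup>*"
    by (rule symp_rtranclp)
  then show ?thesis
    unfolding equiv_def refl_on_def sym_def trans_def knight_path_equiv_def
    by (blast dest: sympD intro: rtranclp_trans)
qed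

end

theory Submission
  imports Defs
begin

text \<open>
  Four knight vectors sum to zero only if they cancel in opposite pairs, so a closed knight path of
  length 4 is a parallelogram spanned by two non-parallel knight vectors. Replacing a vector by its
  opposite only changes the base vertex, which leaves the six pairs of directions from
  (1,2), (2,1), (2,-1), (1,-2). Since the board is a product of intervals, two translates of a set
  that both fit on the board are connected by unit shifts within the board; a reflection of the
  board pairs up the six shapes into three. The set of squared distances is invariant under all
  transformations and separates the three classes.
\<close>

section \<open>Parallelograms and knight vectors\<close>

definition parallelogram :: "cell \<Rightarrow> cell \<Rightarrow> cell \<Rightarrow> cell set" where
  "parallelogram p u v =
     {p, (fst p + fst u, snd p + snd u), (fst p + fst v, snd p + snd v),
      (fst p + fst u + fst v, snd p + snd u + snd v)}"

lemma parallelogram_swap: "parallelogram p u v = parallelogram p v u"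
  unfolding parallelogram_def by (simp add: insert_commute algebra_simps)

lemma parallelogram_flip:
  "parallelogram p u v =
   parallelogram (fst p + fst u, snd p + snd u) (- fst u, - snd u) v"
  unfolding parallelogram_def by (simp add: insert_commute algebra_simps)

text \<open>One vector from each pair of opposite knight vectors, chosen with positive first
  coordinate; no two distinct ones are parallel, and no two of them sum to zero.\<close>

definition knight_directions :: "cell set" where
  "knight_directions = {(1, 2), (2, 1), (2, -1), (1, -2)}"

definition knight_vectors :: "cell set" where
  "knight_vectors = {(1, 2), (2, 1), (2, -1), (1, -2), (-1, -2), (-2, -1), (-2, 1), (-1, 2)}"

lemma knight_move_iff:
  "knight_move c d \<longleftrightarrow> (fst d - fst c, snd d - snd c) \<in> knight_vectors"
proof -
  have "{\<bar>x\<bar>, \<bar>y\<bar>} = {1, 2} \<longleftrightarrow> (- x, - y) \<in> knight_vectors" for x y :: int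
    unfolding doubleton_eq_iff knight_vectors_def by (simp add: abs_if) arith
  from this[of "fst c - fst d" "snd c - snd d"] show ?thesis
    unfolding knight_move_def by simp
qed

lemma knight_vectors_iff:
  "u \<in> knight_vectors \<longleftrightarrow> u \<in> knight_directions \<or> (- fst u, - snd u) \<in> knight_directions"
proof (cases u)
  case (Pair x y)
  have "- x = k \<longleftrightarrow> x = - k" "- y = k \<longleftrightarrow> y = - k" for k :: int
    by auto
  then show ?thesis
    unfolding knight_vectors_def knight_directions_def Pair by simp
qed

lemma knight_directions_vectors:
  assumes "u \<in> knight_directions"
  shows "u \<in> knight_vectors" "(- fst u, - snd u) \<in> knight_vectors"
  using assms unfolding knight_vectors_iff by simp_all

lemma knight_moveE:
  assumes "knight_move c d"
  obtains u where "u \<in> knight_directions" "d = (fst c + fst u, snd c + snd u)"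
  | u where "u \<in> knight_directions" "d = (fst c - fst u, snd c - snd u)"
proof -
  let ?u = "(fst d - fst c, snd d - snd c)" and ?v = "(fst c - fst d, snd c - snd d)"
  have "?u \<in> knight_directions \<or> ?v \<in> knight_directions"
    using assms unfolding knight_move_iff knight_vectors_iff by simp
  then show thesis
    using that(1)[of ?u] that(2)[of ?v] by auto
qed

text \<open>The steps of a closed walk are \<open>u\<close>, \<open>w\<close>,
  \<open>v - u - w\<close> and \<open>- v\<close>. Four knight vectors with zero sum cancel in
  opposite pairs; the hypotheses forbid \<open>u\<close> to cancel \<open>- v\<close> or
  \<open>w\<close>, so \<open>w\<close> has to cancel \<open>- v\<close>. The proof checks all
  triples of knight vectors.\<close>

lemma knight_vectors_sum_zero:
  assumes "u \<in> knight_vectors" "w \<in> knight_vectors" "v \<in> knight_vectors" "u \<noteq> v"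
    and "(fst u + fst w, snd u + snd w) \<noteq> (0, 0)"
    and "(fst v - fst u - fst w, snd v - snd u - snd w) \<in> knight_vectors"
  shows "w = v"
proof -
  have "\<forall>u \<in> knight_vectors. \<forall>w \<in> knight_vectors. \<forall>v \<in> knight_vectors.
     u = v \<or> (fst u + fst w, snd u + snd w) = (0, 0) \<or> w = v \<or>
     (fst v - fst u - fst w, snd v - snd u - snd w) \<notin> knight_vectors"
    unfolding knight_vectors_def ball_simps fst_conv snd_conv by simp
  then show ?thesis using assms by blast
qed

lemma knight_four_cycle_opposite:
  assumes "knight_move a b" "knight_move b c" "knight_move c d" "knight_move a d"
    and "a \<noteq> c" "b \<noteq> d"
  shows "c = (fst b + fst d - fst a, snd b + snd d - snd a)"
proof -
  let ?u = "(fst b - fst a, snd b - snd a)" and ?w = "(fst c - fst b, snd c - snd b)"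
    and ?v = "(fst d - fst a, snd d - snd a)"
  have "?w = ?v"
  proof (rule knight_vectors_sum_zero)
    show "?u \<in> knight_vectors" "?w \<in> knight_vectors" "?v \<in> knight_vectors"
      using assms(1,2,4) unfolding knight_move_iff by auto
    \<comment> \<open>Distinctness of opposite vertices excludes the degenerate cancellations:
      \<open>b \<noteq> d\<close> gives the first claim, \<open>a \<noteq> c\<close> the
      second.\<close>
    show "?u \<noteq> ?v" "(fst ?u + fst ?w, snd ?u + snd ?w) \<noteq> (0, 0)"
      using assms(5,6) by (simp_all add: prod_eq_iff) linarith
    show "(fst ?v - fst ?u - fst ?w, snd ?v - snd ?u - snd ?w) \<in> knight_vectors"
      using assms(3) unfolding knight_move_iff by simp
  qed
  then show ?thesis by (simp add: prod_eq_iff)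
qed

section \<open>Closed knight paths of length 4 as parallelograms\<close>

lemma closed_knight_path4D:
  assumes "S \<in> closed_knight_paths m 4"
  obtains a b c d where "S = {a, b, c, d}" "distinct [a, b, c, d]"
    "knight_move a b" "knight_move b c" "knight_move c d" "knight_move d a"
proof -
  obtain cs where cs: "length cs = 4" "distinct cs" "set cs = S"
      "\<forall>k. Suc k < 4 \<longrightarrow> knight_move (cs ! k) (cs ! Suc k)" "knight_move (last cs) (hd cs)"
    using assms unfolding closed_knight_paths_def by blast
  from cs(1) obtain a b c d where abcd: "cs = [a, b, c, d]"
    by (auto simp: numeral_eq_Suc length_Suc_conv)
  show thesis
    using that[of a b c d] cs(2,3,5) cs(4)[rule_format, of 0] cs(4)[rule_format, of 1]
      cs(4)[rule_format, of 2] unfolding abcd by (simp add: numeral_2_eq_2)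
qed

text \<open>The sides at \<open>a\<close> are directions up to sign. A wrong sign is absorbed by
  moving the base vertex to the other end of that side, which is why \<open>p\<close> need not be
  \<open>a\<close>.\<close>

lemma closed_knight_path4_parallelogram:
  assumes "S \<in> closed_knight_paths m 4"
  obtains p u v where "u \<in> knight_directions" "v \<in> knight_directions" "u \<noteq> v"
    "S = parallelogram p u v"
proof -
  obtain a b c d where abcd: "S = {a, b, c, d}" "distinct [a, b, c, d]"
    "knight_move a b" "knight_move b c" "knight_move c d" "knight_move d a"
    using assms by (rule closed_knight_path4D)
  have ad: "knight_move a d"
    using abcd(6) unfolding knight_move_def by (simp add: abs_minus_commute)
  have c: "c = (fst b + fst d - fst a, snd b + snd d - snd a)"
    using knight_four_cycle_opposite[of a b c d] abcd ad by simp
  have S: "S = parallelogram a (fst b - fst a, snd b - snd a) (fst d - fst a, snd d - snd a)"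
    unfolding abcd(1) c parallelogram_def by (auto simp: algebra_simps)
  have signs: "\<exists>p. S = parallelogram p u v"
    if b: "b = (fst a + fst u, snd a + snd u) \<or> b = (fst a - fst u, snd a - snd u)"
    and d: "d = (fst a + fst v, snd a + snd v) \<or> d = (fst a - fst v, snd a - snd v)" for u v
  proof -
    have 1: "\<exists>p. S = parallelogram p u w" if "S = parallelogram a (- fst u, - snd u) w" for w
      using that parallelogram_flip[of a "(- fst u, - snd u)" w] by auto
    \<comment> \<open>The base \<open>q\<close> is arbitrary here because, when both signs are
      wrong, correcting the first side has already moved the base away from
      \<open>a\<close>.\<close>
    have 2: "\<exists>p. S = parallelogram p w v" if "S = parallelogram q w (- fst v, - snd v)" for q w
      using that parallelogram_flip[of q "(- fst v, - snd v)" w] parallelogram_swap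
      by (metis add.inverse_inverse fst_conv snd_conv prod.collapse)
    have "S = parallelogram a u v \<or> S = parallelogram a (- fst u, - snd u) v
       \<or> S = parallelogram a u (- fst v, - snd v)
       \<or> S = parallelogram a (- fst u, - snd u) (- fst v, - snd v)"
      using b d S by auto
    then show ?thesis using 1 2 by metis
  qed
  have neq: "u \<noteq> v"
    if b: "b = (fst a + fst u, snd a + snd u) \<or> b = (fst a - fst u, snd a - snd u)"
    and d: "d = (fst a + fst v, snd a + snd v) \<or> d = (fst a - fst v, snd a - snd v)" for u v
  proof
    assume "u = v"
    \<comment> \<open>With equal signs the two neighbours of \<open>a\<close> coincide; with
      opposite signs they are symmetric about \<open>a\<close>, and the parallelogram law puts
      \<open>c\<close> at \<open>a\<close>.\<close>
    then have "b = d \<or> c = a"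
      using b d c by (elim disjE) (simp_all add: prod_eq_iff)
    then show False using abcd(2) by auto
  qed
  obtain u where u: "u \<in> knight_directions"
    "b = (fst a + fst u, snd a + snd u) \<or> b = (fst a - fst u, snd a - snd u)"
    using abcd(3) by (meson knight_moveE)
  obtain v where v: "v \<in> knight_directions"
    "d = (fst a + fst v, snd a + snd v) \<or> d = (fst a - fst v, snd a - snd v)"
    using ad by (meson knight_moveE)
  show thesis
    using signs[OF u(2) v(2)] neq[OF u(2) v(2)] u(1) v(1) that by blast
qed

section \<open>Translations within the board\<close>

definition translate :: "int \<Rightarrow> int \<Rightarrow> cell set \<Rightarrow> cell set" where
  "translate a b S = (\<lambda>(i, j). (i + a, j + b)) ` S"

lemma translate_translate: "translate a b (translate c d S) = translate (c + a) (d + b) S"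
  unfolding translate_def by (auto simp: image_image split_beta add.assoc)

lemma translate_0 [simp]: "translate 0 0 S = S"
  unfolding translate_def by auto

lemma translate_subset_board_iff:
  "translate a b S \<subseteq> board m \<longleftrightarrow>
     (\<forall>(i, j) \<in> S. 1 \<le> i + a \<and> i + a \<le> int m \<and> 1 \<le> j + b \<and> j + b \<le> int m)"
  unfolding translate_def board_def by fastforce

lemma subset_board_iff:
  "S \<subseteq> board m \<longleftrightarrow> (\<forall>(i, j) \<in> S. 1 \<le> i \<and> i \<le> int m \<and> 1 \<le> j \<and> j \<le> int m)"
  using translate_subset_board_iff[of 0 0] by simp

lemma elementary_steps_sym:
  "(elementary_step m)\<^sup>*\<^sup>* S T \<Longrightarrow> (elementary_step m)\<^sup>*\<^sup>* T S"
  using symp_rtranclp[OF sympI[OF elementary_step_sym]] by (rule sympD)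

lemma elementary_step_unit_translate:
  assumes "S \<subseteq> board m" "translate a b S \<subseteq> board m" "(a, b) = (1, 0) \<or> (a, b) = (0, 1)"
  shows "elementary_step m S (translate a b S)"
  using assms unfolding elementary_step_def unit_shifts_def translate_def by auto

lemma translate_nat_steps:
  assumes "S \<subseteq> board m" "translate (int k * a) (int k * b) S \<subseteq> board m"
    "(a, b) = (1, 0) \<or> (a, b) = (0, 1)"
  shows "(elementary_step m)\<^sup>*\<^sup>* S (translate (int k * a) (int k * b) S)"
  using assms(2)
proof (induction k)
  case 0
  then show ?case by simp
next
  case (Suc k)
  let ?T = "translate (int k * a) (int k * b) S"
  \<comment> \<open>Each coordinate of the intermediate position lies between its values in
    \<open>S\<close> and in the final translate, both on the board; intervals are convex.\<close>
  have T: "?T \<subseteq> board m"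
    unfolding translate_subset_board_iff
  proof (intro ballI, clarify)
    fix i j
    assume "(i, j) \<in> S"
    then have "1 \<le> i \<and> i \<le> int m \<and> 1 \<le> j \<and> j \<le> int m"
      "1 \<le> i + int (Suc k) * a \<and> i + int (Suc k) * a \<le> int m \<and>
       1 \<le> j + int (Suc k) * b \<and> j + int (Suc k) * b \<le> int m"
      using Suc.prems assms(1)
      unfolding translate_subset_board_iff subset_board_iff[of S] by blast+
    then show "1 \<le> i + int k * a \<and> i + int k * a \<le> int m \<and>
       1 \<le> j + int k * b \<and> j + int k * b \<le> int m"
      using assms(3) by auto
  qed
  have eq: "translate (int (Suc k) * a) (int (Suc k) * b) S = translate a b ?T"
    unfolding translate_translate by (simp add: algebra_simps)
  have "elementary_step m ?T (translate a b ?T)"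
    using T Suc.prems assms(3) unfolding eq by (rule elementary_step_unit_translate)
  with Suc.IH[OF T] show ?case unfolding eq by (rule rtranclp.rtrancl_into_rtrancl)
qed

lemma translate_axis_steps:
  assumes "S \<subseteq> board m" "translate (k * a) (k * b) S \<subseteq> board m"
    "(a, b) = (1, 0) \<or> (a, b) = (0, 1)"
  shows "(elementary_step m)\<^sup>*\<^sup>* S (translate (k * a) (k * b) S)"
proof (cases "k \<ge> 0")
  case True
  then show ?thesis using translate_nat_steps[of S m "nat k" a b] assms by simp
next
  case False
  let ?T = "translate (k * a) (k * b) S"
  \<comment> \<open>A negative shift is a nonnegative shift from \<open>?T\<close> back to
    \<open>S\<close>, traversed in reverse.\<close>
  have "S = translate (int (nat (- k)) * a) (int (nat (- k)) * b) ?T"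
    using False by (simp add: translate_translate)
  then show ?thesis
    using translate_nat_steps[of ?T m "nat (- k)" a b] assms elementary_steps_sym by metis
qed

lemma translate_steps:
  assumes "S \<subseteq> board m" "translate a b S \<subseteq> board m"
  shows "(elementary_step m)\<^sup>*\<^sup>* S (translate a b S)"
proof -
  let ?T = "translate a 0 S"
  \<comment> \<open>The corner position takes its first coordinates from the target and its second
    coordinates from \<open>S\<close>, so it fits because the board is a product.\<close>
  have T: "?T \<subseteq> board m"
    using assms unfolding translate_subset_board_iff subset_board_iff[of S] by fastforce
  have eq: "translate a b S = translate 0 b ?T"
    by (simp add: translate_translate)
  have "(elementary_step m)\<^sup>*\<^sup>* S ?T"
    using translate_axis_steps[of S m a 1 0] assms(1) T by simp
  moreover have "(elementary_step m)\<^sup>*\<^sup>* ?T (translate 0 b ?T)"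
    using translate_axis_steps[of ?T m b 0 1] assms(2) T unfolding eq by simp
  ultimately show ?thesis unfolding eq by (rule rtranclp_trans)
qed

lemma parallelogram_steps:
  assumes "parallelogram p u v \<subseteq> board m" "parallelogram q u v \<subseteq> board m"
  shows "(elementary_step m)\<^sup>*\<^sup>* (parallelogram p u v) (parallelogram q u v)"
proof -
  have "parallelogram q u v = translate (fst q - fst p) (snd q - snd p) (parallelogram p u v)"
    unfolding parallelogram_def translate_def by (cases p, cases q) (simp add: algebra_simps)
  then show ?thesis using translate_steps assms by metis
qed

section \<open>The invariant of squared distances\<close>

definition sq_dists :: "cell set \<Rightarrow> int set" where
  "sq_dists S = (\<lambda>(x, y). (fst x - fst y)\<^sup>2 + (snd x - snd y)\<^sup>2) ` (S \<times> S)"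

lemma sq_dists_image:
  assumes "\<And>x y. (fst (f x) - fst (f y))\<^sup>2 + (snd (f x) - snd (f y))\<^sup>2
                = (fst x - fst y)\<^sup>2 + (snd x - snd y)\<^sup>2"
  shows "sq_dists (f ` S) = sq_dists S"
proof -
  have "f ` S \<times> f ` S = map_prod f f ` (S \<times> S)" by auto
  then show ?thesis
    unfolding sq_dists_def by (simp add: image_image split_beta assms)
qed

text \<open>Unit shifts, quarter turns and reflections are all isometries of the plane.\<close>

lemma elementary_step_sq_dists:
  assumes "elementary_step m S T"
  shows "sq_dists T = sq_dists S"
proof -
  obtain f where f: "f \<in> unit_shifts \<union> quarter_turns m \<union> board_reflections m" "T = f ` S"
    using assms unfolding elementary_step_def by blast
  have "(fst (f x) - fst (f y))\<^sup>2 + (snd (f x) - snd (f y))\<^sup>2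
      = (fst x - fst y)\<^sup>2 + (snd x - snd y)\<^sup>2" for x y
    using f(1) unfolding unit_shifts_def quarter_turns_def board_reflections_def Un_iff insert_iff
      empty_iff
    by (elim disjE) (simp_all add: split_beta power2_eq_square algebra_simps)
  then show ?thesis unfolding f(2) by (rule sq_dists_image)
qed

lemma elementary_steps_sq_dists:
  "(elementary_step m)\<^sup>*\<^sup>* S T \<Longrightarrow> sq_dists T = sq_dists S"
  by (induction rule: rtranclp_induct) (auto dest: elementary_step_sq_dists)

section \<open>The three representative shapes\<close>

definition thin_rhombus :: "cell set" where
  "thin_rhombus = parallelogram (1, 1) (1, 2) (2, 1)"

text \<open>Its second coordinates span five values, so 3 is the only second coordinate of the base
  vertex that fits on the board of side 5.\<close>

definition tall_rhombus :: "cell set" where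
  "tall_rhombus = parallelogram (1, 3) (1, 2) (1, -2)"

definition tilted_square :: "cell set" where
  "tilted_square = parallelogram (1, 2) (1, 2) (2, -1)"

lemmas shape_defs = thin_rhombus_def tall_rhombus_def tilted_square_def

lemma parallelogram_closed_knight_path:
  assumes "parallelogram p u v \<subseteq> board m"
    and "u \<in> knight_directions" "v \<in> knight_directions" "u \<noteq> v"
  shows "parallelogram p u v \<in> closed_knight_paths m 4"
proof -
  \<comment> \<open>The vertices in boundary order, with successive steps \<open>u\<close>,
    \<open>v\<close>, \<open>- u\<close>, \<open>- v\<close>.\<close>
  let ?cs = "[p, (fst p + fst u, snd p + snd u), (fst p + fst u + fst v, snd p + snd u + snd v),
    (fst p + fst v, snd p + snd v)]"
  have "distinct ?cs"
    using assms(2-4) unfolding knight_directions_def by (cases p) auto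
  moreover have "set ?cs = parallelogram p u v"
    unfolding parallelogram_def by auto
  moreover have "knight_move (?cs ! k) (?cs ! Suc k)" if "Suc k < 4" for k
  proof -
    have "k = 0 \<or> k = 1 \<or> k = 2" using that by auto
    then show ?thesis
      using knight_directions_vectors assms(2,3) by (elim disjE) (simp_all add: knight_move_iff)
  qed
  moreover have "knight_move (last ?cs) (hd ?cs)"
    using knight_directions_vectors[OF assms(3)] by (simp add: knight_move_iff)
  ultimately show ?thesis
    using assms(1) unfolding closed_knight_paths_def
    by (intro CollectI conjI exI[of _ ?cs]) auto
qed

lemma shapes_closed_knight_paths:
  "thin_rhombus \<in> closed_knight_paths 5 4"
  "tall_rhombus \<in> closed_knight_paths 5 4"
  "tilted_square \<in> closed_knight_paths 5 4"
  unfolding shape_defs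
  by (rule parallelogram_closed_knight_path;
      simp add: parallelogram_def board_def knight_directions_def)+

lemma closed_knight_path_reaches_shape:
  assumes S: "S \<in> closed_knight_paths 5 4"
  shows "\<exists>K \<in> {thin_rhombus, tall_rhombus, tilted_square}. (elementary_step 5)\<^sup>*\<^sup>* K S"
proof -
  obtain p u v where uv: "u \<in> knight_directions" "v \<in> knight_directions" "u \<noteq> v"
    and Sp: "S = parallelogram p u v"
    using S by (rule closed_knight_path4_parallelogram)
  have board: "parallelogram p u v \<subseteq> board 5"
    using S Sp unfolding closed_knight_paths_def by blast
  have direct: "(elementary_step 5)\<^sup>*\<^sup>* K S"
    if "{u, v} = {x, y}" "parallelogram q x y = K" "K \<subseteq> board 5" for K q x y
  proof -
    have "K = parallelogram q u v"
      using that(1,2) parallelogram_swap unfolding doubleton_eq_iff by blast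
    then show ?thesis using parallelogram_steps that(3) board unfolding Sp by simp
  qed
  have reflected: "(elementary_step 5)\<^sup>*\<^sup>* K S"
    if "{u, v} = {x, y}" "parallelogram q x y = f ` K"
      "f \<in> board_reflections 5" "K \<subseteq> board 5" "f ` K \<subseteq> board 5" for K q x y f
  proof -
    have "elementary_step 5 K (f ` K)"
      using that(3-5) unfolding elementary_step_def by blast
    moreover have "(elementary_step 5)\<^sup>*\<^sup>* (f ` K) S"
      using direct that(1,2,5) by blast
    ultimately show ?thesis by (rule converse_rtranclp_into_rtranclp)
  qed
  \<comment> \<open>Up to sign, \<open>?h\<close> turns the direction pair of
    \<open>thin_rhombus\<close> into (2,-1), (1,-2). It preserves that of
    \<open>tall_rhombus\<close>, so the transposition \<open>?t\<close> serves there;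
    \<open>?t\<close> also handles \<open>tilted_square\<close>.\<close>
  let ?h = "\<lambda>(i, j). (int 5 + 1 - i, j)" and ?t = "\<lambda>(i, j). (j, i)"
  have refl: "?h \<in> board_reflections 5" "?t \<in> board_reflections 5"
    unfolding board_reflections_def by auto
  have on_board: "thin_rhombus \<subseteq> board 5" "tall_rhombus \<subseteq> board 5" "tilted_square \<subseteq> board 5"
    using shapes_closed_knight_paths unfolding closed_knight_paths_def by blast+
  have h: "?h ` thin_rhombus \<subseteq> board 5"
    and t: "?t ` tall_rhombus \<subseteq> board 5" "?t ` tilted_square \<subseteq> board 5"
    unfolding shape_defs parallelogram_def board_def by auto
  \<comment> \<open>Each base is the vertex of the reflected shape with least first coordinate,
    since directions have positive first coordinate.\<close>
  have h_eq: "parallelogram (2, 4) (2, -1) (1, -2) = ?h ` thin_rhombus"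
    and t_eq: "parallelogram (1, 2) (2, 1) (2, -1) = ?t ` tall_rhombus"
      "parallelogram (1, 3) (2, 1) (1, -2) = ?t ` tilted_square"
    unfolding shape_defs parallelogram_def by auto
  have "{u, v} = {(1, 2), (2, 1)} \<or> {u, v} = {(2, -1), (1, -2)} \<or> {u, v} = {(1, 2), (1, -2)}
      \<or> {u, v} = {(2, 1), (2, -1)} \<or> {u, v} = {(1, 2), (2, -1)} \<or> {u, v} = {(2, 1), (1, -2)}"
    using uv unfolding knight_directions_def insert_iff empty_iff
    by (elim disjE) (simp_all add: doubleton_eq_iff)
  then have "(elementary_step 5)\<^sup>*\<^sup>* thin_rhombus S \<or> (elementary_step 5)\<^sup>*\<^sup>* tall_rhombus S
      \<or> (elementary_step 5)\<^sup>*\<^sup>* tilted_square S"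
    using direct[OF _ thin_rhombus_def[symmetric] on_board(1)]
      reflected[OF _ h_eq refl(1) on_board(1) h]
      direct[OF _ tall_rhombus_def[symmetric] on_board(2)]
      reflected[OF _ t_eq(1) refl(2) on_board(2) t(1)]
      direct[OF _ tilted_square_def[symmetric] on_board(3)]
      reflected[OF _ t_eq(2) refl(2) on_board(3) t(2)]
    by blast
  then show ?thesis by blast
qed

text \<open>Equal cells contribute 0 and the sides 5; the other values come from the diagonals,
  which have equal length only in the square.\<close>

lemma sq_dists_shapes:
  "sq_dists thin_rhombus = {0, 5, 2, 18}"
  "sq_dists tall_rhombus = {0, 5, 4, 16}"
  "sq_dists tilted_square = {0, 5, 10}"
  unfolding sq_dists_def shape_defs parallelogram_def by auto

section \<open>Counting the classes\<close>

lemma card_quotient_3: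
  assumes "equiv A R" "x \<in> A" "y \<in> A" "z \<in> A"
    and "\<And>a. a \<in> A \<Longrightarrow> (x, a) \<in> R \<or> (y, a) \<in> R \<or> (z, a) \<in> R"
    and "(x, y) \<notin> R" "(x, z) \<notin> R" "(y, z) \<notin> R"
  shows "card (A // R) = 3"
proof -
  have "A // R = {R `` {x}, R `` {y}, R `` {z}}"
  proof
    show "A // R \<subseteq> {R `` {x}, R `` {y}, R `` {z}}"
      using assms(5) equiv_class_eq[OF assms(1)] unfolding quotient_def by blast
    show "{R `` {x}, R `` {y}, R `` {z}} \<subseteq> A // R"
      using assms(2-4) by (auto intro: quotientI)
  qed
  moreover have "R `` {x} \<noteq> R `` {y}" "R `` {x} \<noteq> R `` {z}" "R `` {y} \<noteq> R `` {z}"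
    using assms eq_equiv_class by metis+
  ultimately show ?thesis by simp
qed

theorem mainTheorem1:
  fixes n :: nat
  assumes "n = 4"
  shows "card (closed_knight_paths (n + 1) n // knight_path_equiv (n + 1) n) = 3"
proof -
  have separated: "(S, T) \<notin> knight_path_equiv 5 4" if "sq_dists S \<noteq> sq_dists T" for S T
    using that elementary_steps_sq_dists unfolding knight_path_equiv_def by blast
  have "card (closed_knight_paths 5 4 // knight_path_equiv 5 4) = 3"
  proof (rule card_quotient_3[OF equiv_knight_path_equiv shapes_closed_knight_paths])
    fix S
    assume "S \<in> closed_knight_paths 5 4"
    then show "(thin_rhombus, S) \<in> knight_path_equiv 5 4 \<or>
        (tall_rhombus, S) \<in> knight_path_equiv 5 4 \<or> (tilted_square, S) \<in> knight_path_equiv 5 4"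
      using closed_knight_path_reaches_shape shapes_closed_knight_paths
      unfolding knight_path_equiv_def by blast
  qed (rule separated; simp add: sq_dists_shapes; simp add: set_eq_iff; presburger)+
  then show ?thesis using assms by simp
qed

end
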